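(* Let $r\ge 1$ and $k\ge 2$ be integers, let $\mathbf a=(a_1,\dots,a_r)$ be a sequence of positive integers, and let $D=\operatorname{lcm}(a_1,\dots,a_r)$. Then the restricted $k$-multipartition function $p_{k,\mathbf a}$ is a quasi-polynomial of degree $rk-1$ with period $D$; that is, there exist functions $d_{k,\mathbf a,m}$ on the nonnegative integers, $0\le m\le rk-1$, such that $$p_{k,\mathbf a}(n)=d_{k,\mathbf a,rk-1}(n)n^{rk-1}+\cdots+d_{k,\mathbf a,1}(n)n+d_{k,\mathbf a,0}(n)\qquad\text{for all } n\ge 0,$$ $d_{k,\mathbf a,m}(n+D)=d_{k,\mathbf a,m}(n)$ for all $0\le m\le rk-1$ and $n\ge 0$, and $d_{k,\mathbf a,rk-1}$ is not identically zero.
   Context: For integers $n\ge 0$, $p_{k,\mathbf a}(n)$ is the number of $k$-tuples $(x^1,\dots,x^k)$ of vectors $x^j=(x^j_1,\dots,x^j_r)\in\mathbb N^r$ (with $0\in\mathbb N$) such that $\sum_{j=1}^k\sum_{i=1}^r a_i x^j_i=n$. Equivalently, $\sum_{n\ge 0}p_{k,\mathbf a}(n)z^n=\prod_{i=1}^r(1-z^{a_i})^{-k}$ for $|z|<1$. *)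

theory Defs
  imports Complex_Main
begin

text \<open>
  A vector in \<open>\<nat>\<^sup>r\<close> is a list of length \<open>r\<close>, a \<open>k\<close>-tuple of such vectors a list of
  length \<open>k\<close>; the indices \<open>1, \<dots>, r\<close> and \<open>1, \<dots>, k\<close> are thus shifted to
  \<open>0, \<dots>, r - 1\<close> and \<open>0, \<dots>, k - 1\<close>.
\<close>

definition multipartitions :: "nat \<Rightarrow> nat list \<Rightarrow> nat \<Rightarrow> nat list list set" where
  "multipartitions k a n =
     {x. length x = k \<and> (\<forall>j<k. length (x ! j) = length a) \<and>
         (\<Sum>j<k. \<Sum>i<length a. a ! i * x ! j ! i) = n}"

definition multipartition_count :: "nat \<Rightarrow> nat list \<Rightarrow> nat \<Rightarrow> nat" where
  "multipartition_count k a n = card (multipartitions k a n)"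

text \<open>For positive \<open>a\<^sub>i\<close>, the cardinality above is that of a finite set.\<close>

lemma finite_multipartitions:
  assumes pos: "\<forall>i<length a. 0 < a ! i"
  shows "finite (multipartitions k a n)"
proof (rule finite_subset)
  let ?V = "{v. set v \<subseteq> {..n} \<and> length v = length a}"
  show "finite {x. set x \<subseteq> ?V \<and> length x = k}"
    by (intro finite_lists_length_eq) auto
  show "multipartitions k a n \<subseteq> {x. set x \<subseteq> ?V \<and> length x = k}"
  proof
    fix x assume x: "x \<in> multipartitions k a n"
    have le: "x ! j ! i \<le> n" if ji: "j < k" "i < length a" for j i
    proof -
      have "x ! j ! i \<le> a ! i * x ! j ! i" using pos ji by (simp add: Suc_leI)
      also have "\<dots> \<le> (\<Sum>i<length a. a ! i * x ! j ! i)"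
        using ji by (intro member_le_sum) auto
      also have "\<dots> \<le> (\<Sum>j<k. \<Sum>i<length a. a ! i * x ! j ! i)"
        using ji by (intro member_le_sum[of j "{..<k}" "\<lambda>j. \<Sum>i<length a. a ! i * x ! j ! i"]) auto
      also have "\<dots> = n" using x by (simp add: multipartitions_def)
      finally show ?thesis .
    qed
    have len: "length x = k" "\<And>j. j < k \<Longrightarrow> length (x ! j) = length a"
      using x by (auto simp: multipartitions_def)
    show "x \<in> {x. set x \<subseteq> ?V \<and> length x = k}"
      using le len by (fastforce simp: in_set_conv_nth)
  qed
qed

text \<open>The period \<open>D\<close> is not required to be minimal.\<close>

definition quasi_polynomial :: "nat \<Rightarrow> nat \<Rightarrow> (nat \<Rightarrow> real) \<Rightarrow> bool" where
  "quasi_polynomial deg D f \<longleftrightarrow>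
     (\<exists>d :: nat \<Rightarrow> nat \<Rightarrow> real.
        (\<forall>n. f n = (\<Sum>m\<le>deg. d m n * real n ^ m)) \<and>
        (\<forall>m\<le>deg. \<forall>n. d m (n + D) = d m n) \<and>
        (\<exists>n. d deg n \<noteq> 0))"

end

theory Submission
  imports Defs "HOL-Computational_Algebra.Polynomial_FPS"
    "HOL-Computational_Algebra.Formal_Laurent_Series"
begin

text \<open>
  The generating function of \<open>p\<^bsub>k,a\<^esub>\<close> is \<open>(\<Prod>\<^sub>i (1 - X^a\<^sub>i))^(- k)\<close>
  (\<open>multipartition_count_fps\<close>). Every \<open>1 - X^a\<^sub>i\<close> divides \<open>1 - X^D\<close>, with the
  geometric sum \<open>1 + X^a\<^sub>i + \<dots> + X^(D - a\<^sub>i)\<close> as quotient. Expanding with these quotients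
  turns the generating function into \<open>N / (1 - X^D)^s\<close>, where \<open>s = r k\<close> and \<open>N\<close> is a
  polynomial with \<open>deg N < s D\<close> and \<open>N(1) \<noteq> 0\<close>
  (\<open>rational_fps_common_denominator\<close>).

  Such a quotient always has quasi-polynomial coefficients of degree \<open>s - 1\<close>
  (\<open>quasi_polynomial_if_rational_fps\<close>). The series \<open>(1 - X^D)^(- s)\<close> has the coefficient
  \<open>B(q) = (q + s - 1) choose (s - 1)\<close> at \<open>D q\<close>, and \<open>B\<close> is a polynomial of degree
  \<open>s - 1\<close>. So the \<open>n\<close>-th coefficient is the sum of \<open>N\<^sub>j B((n - j) / D)\<close> over those
  \<open>j \<le> n\<close> that are congruent to \<open>n\<close> modulo \<open>D\<close>. For the formula to hold at every
  \<open>n \<ge> 0\<close>, and not only for large \<open>n\<close>, the constraint \<open>j \<le> n\<close> must be removable: for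
  \<open>n < j < s D\<close> the argument \<open>(n - j) / D\<close> is one of \<open>-1, \<dots>, -(s - 1)\<close>, which are
  exactly the roots of \<open>B\<close>. The range of summation then depends only on the residue class of
  \<open>n\<close>. Finally, the leading coefficients of the \<open>D\<close> residue classes add up to a positive
  multiple of \<open>N(1)\<close>, hence they are not all zero.
\<close>

section \<open>Generating functions of weighted sets\<close>

definition weight_fps :: "'a set \<Rightarrow> ('a \<Rightarrow> nat) \<Rightarrow> real fps" where
  "weight_fps A w = Abs_fps (\<lambda>n. real (card {x \<in> A. w x = n}))"

text \<open>
  An infinite fibre would have cardinality \<open>0\<close> and break the product formula below, so
  finiteness is carried along through the constructions.
\<close>

definition finite_fibres :: "'a set \<Rightarrow> ('a \<Rightarrow> nat) \<Rightarrow> bool" where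
  "finite_fibres A w \<longleftrightarrow> (\<forall>n. finite {x \<in> A. w x = n})"

text \<open>
  Additive weights on a product multiply generating functions: the fibre over \<open>n\<close> splits
  according to the weight \<open>i \<le> n\<close> of the first component, which is the Cauchy product.
  Stated for \<open>Cons\<close>, this one rule builds up both the vectors and the tuples of vectors.
\<close>

lemma weight_fps_Cons:
  assumes A: "finite_fibres A u" and B: "finite_fibres B v"
    and C: "C = {x # xs |x xs. x \<in> A \<and> xs \<in> B}"
    and w: "\<And>x xs. x \<in> A \<Longrightarrow> xs \<in> B \<Longrightarrow> w (x # xs) = u x + v xs"
  shows "finite_fibres C w" "weight_fps C w = weight_fps A u * weight_fps B v"
proof -
  define S where
    "S n = (SIGMA i:{..n}. {x \<in> A. u x = i} \<times> {xs \<in> B. v xs = n - i})" for n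
  have fibre: "{l \<in> C. w l = n} = (\<lambda>(i, x, xs). x # xs) ` S n" for n
    unfolding C S_def using w by (force simp: image_iff)
  have inj: "inj_on (\<lambda>(i, x, xs). x # xs) (S n)" for n
    by (auto simp: inj_on_def S_def)
  have finS: "finite (S n)" for n
    using A B by (auto simp: S_def finite_fibres_def)
  show "finite_fibres C w"
    by (simp add: finite_fibres_def fibre finS)
  have "card {l \<in> C. w l = n} =
      (\<Sum>i\<le>n. card {x \<in> A. u x = i} * card {xs \<in> B. v xs = n - i})" for n
    unfolding fibre card_image[OF inj] unfolding S_def
    using A B by (subst card_SigmaI) (auto simp: finite_fibres_def card_cartesian_product)
  then show "weight_fps C w = weight_fps A u * weight_fps B v"
    by (simp add: weight_fps_def fps_eq_iff fps_mult_nth atLeast0AtMost)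
qed

lemma weight_fps_lists:
  assumes "finite_fibres A w"
  shows "finite_fibres {xs. length xs = k \<and> set xs \<subseteq> A} (\<lambda>xs. \<Sum>x\<leftarrow>xs. w x) \<and>
    weight_fps {xs. length xs = k \<and> set xs \<subseteq> A} (\<lambda>xs. \<Sum>x\<leftarrow>xs. w x) = weight_fps A w ^ k"
proof (induction k)
  case 0
  have "{xs. (length xs = 0 \<and> set xs \<subseteq> A) \<and> (\<Sum>x\<leftarrow>xs. w x) = n} =
      (if n = 0 then {[]} else {})" for n
    by auto
  then show ?case
    by (auto simp: finite_fibres_def weight_fps_def fps_eq_iff)
next
  case (Suc k)
  have "{xs. length xs = Suc k \<and> set xs \<subseteq> A} =
      {x # xs |x xs. x \<in> A \<and> xs \<in> {xs. length xs = k \<and> set xs \<subseteq> A}}"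
    by (auto simp: length_Suc_conv)
  from weight_fps_Cons[OF assms conjunct1[OF Suc.IH] this] Suc.IH show ?case
    by simp
qed

lemma weight_fps_multiples:
  assumes "0 < a"
  shows "finite_fibres UNIV ((*) a)" "weight_fps UNIV ((*) a) * (1 - fps_X ^ a) = 1"
proof -
  have fibre: "{x. a * x = n} = (if a dvd n then {n div a} else {})" for n
    using assms by auto
  then show "finite_fibres UNIV ((*) a)"
    by (auto simp: finite_fibres_def)
  show "weight_fps UNIV ((*) a) * (1 - fps_X ^ a) = 1"
    using assms
    by (auto simp: weight_fps_def fibre fps_eq_iff right_diff_distrib fps_X_power_mult_right_nth
        dvd_minus_self dest: dvd_imp_le)
qed

text \<open>
  Choosing the entries of a vector one after the other contributes a geometric series
  \<open>(1 - X^a)^(- 1)\<close> per entry. The identity is written without inverses so that the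
  factors can be cancelled by plain ring arithmetic.
\<close>

lemma weight_fps_vectors:
  assumes "\<forall>a \<in> set as. 0 < a"
  shows "finite_fibres {v. length v = length as} (\<lambda>v. \<Sum>i<length as. as ! i * v ! i) \<and>
    weight_fps {v. length v = length as} (\<lambda>v. \<Sum>i<length as. as ! i * v ! i)
      * (\<Prod>a\<leftarrow>as. 1 - fps_X ^ a) = 1"
  using assms
proof (induction as)
  case Nil
  have "{v :: nat list. v = [] \<and> n = 0} = (if n = 0 then {[]} else {})" for n :: nat
    by auto
  then show ?case
    by (auto simp: finite_fibres_def weight_fps_def fps_eq_iff)
next
  case (Cons a as)
  then have "0 < a" and IH:
    "finite_fibres {v. length v = length as} (\<lambda>v. \<Sum>i<length as. as ! i * v ! i)"
    "weight_fps {v. length v = length as} (\<lambda>v. \<Sum>i<length as. as ! i * v ! i)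
      * (\<Prod>a\<leftarrow>as. 1 - fps_X ^ a) = 1"
    by auto
  have C: "{v. length v = length (a # as)} =
      {x # xs |x xs. x \<in> UNIV \<and> xs \<in> {v :: nat list. length v = length as}}"
    by (auto simp: length_Suc_conv)
  have w: "(\<Sum>i<length (a # as). (a # as) ! i * (x # xs) ! i) =
      a * x + (\<Sum>i<length as. as ! i * xs ! i)" for x xs
    by (simp del: sum.lessThan_Suc add: sum.lessThan_Suc_shift)
  note prod = weight_fps_Cons[OF weight_fps_multiples(1)[OF \<open>0 < a\<close>] IH(1) C,
      where w = "\<lambda>v. \<Sum>i<length (a # as). (a # as) ! i * v ! i", OF w]
  have "weight_fps {v. length v = length (a # as)} (\<lambda>v. \<Sum>i<length (a # as). (a # as) ! i * v ! i)
      * (\<Prod>a\<leftarrow>a # as. 1 - fps_X ^ a) =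
      (weight_fps UNIV ((*) a) * (1 - fps_X ^ a)) *
      (weight_fps {v. length v = length as} (\<lambda>v. \<Sum>i<length as. as ! i * v ! i)
        * (\<Prod>a\<leftarrow>as. 1 - fps_X ^ a))"
    unfolding prod(2) by (simp add: algebra_simps)
  with prod(1) show ?case
    unfolding weight_fps_multiples(2)[OF \<open>0 < a\<close>] IH(2) by simp
qed

lemma multipartition_count_fps:
  assumes "\<forall>a \<in> set as. 0 < a"
  shows "Abs_fps (\<lambda>n. real (multipartition_count k as n)) * (\<Prod>a\<leftarrow>as. 1 - fps_X ^ a) ^ k = 1"
proof -
  let ?V = "{v. length v = length as}" and ?w = "\<lambda>v. \<Sum>i<length as. as ! i * v ! i"
  note V = weight_fps_vectors[OF assms]
  have "multipartitions k as n =
      {x \<in> {xs. length xs = k \<and> set xs \<subseteq> ?V}. (\<Sum>v\<leftarrow>x. ?w v) = n}" for n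
    unfolding multipartitions_def
    by (auto simp: sum_list_sum_nth in_set_conv_nth atLeast0LessThan subset_iff)
  then have "Abs_fps (\<lambda>n. real (multipartition_count k as n)) = weight_fps ?V ?w ^ k"
    using weight_fps_lists[OF conjunct1[OF V], of k]
    by (simp add: multipartition_count_def weight_fps_def)
  with V show ?thesis
    by (simp flip: power_mult_distrib)
qed

section \<open>Rational generating functions and quasi-polynomials\<close>

text \<open>
  This is \<open>(x + m) choose m\<close> as a polynomial in \<open>x\<close>.
\<close>

definition binomial_poly :: "nat \<Rightarrow> real poly" where
  "binomial_poly m = smult (1 / fact m) (\<Prod>i<m. [:1 + real i, 1:])"

lemma binomial_poly_degree: "degree (binomial_poly m) = m"
  by (simp add: binomial_poly_def degree_prod_sum_eq)

lemma binomial_poly_lead_coeff: "coeff (binomial_poly m) m = 1 / fact m"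
proof -
  have "lead_coeff (binomial_poly m) = 1 / fact m"
    by (simp add: binomial_poly_def lead_coeff_prod del: lead_coeff_smult) 
  then show ?thesis
    by (simp add: binomial_poly_degree)
qed

lemma poly_binomial_poly: "poly (binomial_poly m) x = pochhammer (x + 1) m / fact m"
  by (simp add: binomial_poly_def poly_prod pochhammer_prod atLeast0LessThan algebra_simps)

lemma poly_binomial_poly_of_nat: "poly (binomial_poly m) (real q) = real ((m + q) choose m)"
  by (simp add: poly_binomial_poly binomial_gbinomial gbinomial_pochhammer' algebra_simps)

lemma poly_binomial_poly_eq_0:
  assumes "0 < q" "q \<le> m"
  shows "poly (binomial_poly m) (- real q) = 0"
  using assms
  by (auto simp: poly_binomial_poly pochhammer_eq_0_iff intro!: exI[of _ "q - 1"])

text \<open>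
  Substituting \<open>X^D\<close> for \<open>X\<close> in the negative binomial series
  \<open>(1 - X)^(- (m + 1))\<close>.
\<close>

lemma inverse_one_minus_fps_X_power_nth:
  assumes "0 < D"
  shows "inverse ((1 - fps_X ^ D) ^ Suc m) $ n =
    (if D dvd n then real ((m + n div D) choose m) else 0)"
proof -
  let ?g = "(1 - fps_X :: real fps) ^ Suc m"
  have "(1 - fps_X ^ D) ^ Suc m = ?g oo fps_X ^ D"
    using assms
    by (simp add: fps_compose_power[symmetric] fps_compose_sub_distrib del: power_Suc)
  also have "inverse \<dots> = inverse ?g oo fps_X ^ D"
    using assms by (subst fps_inverse_compose) (auto simp del: power_Suc)
  also have "inverse ?g = Abs_fps (\<lambda>k. real ((m + k) choose m))"
    using one_minus_const_fps_X_neg_power'[of "Suc m" "1::real"]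
    by (simp add: binomial_symmetric[of m] del: power_Suc)
  finally show ?thesis
    using assms by (simp add: fps_nth_compose_X_power del: power_Suc)
qed


text \<open>
  The two hypotheses on \<open>P\<close> have separate purposes. The degree bound makes the formula valid
  from \<open>n = 0\<close> on, because it confines the indices \<open>j > n\<close> to roots of the binomial
  polynomial. The condition \<open>P(1) \<noteq> 0\<close> prevents cancellation of a factor \<open>1 - X\<close>, the
  pole at \<open>1\<close> being what produces growth of order \<open>n^m\<close> on average.
\<close>

lemma quasi_polynomial_if_rational_fps:
  assumes "0 < D" and deg: "degree P < Suc m * D" and P1: "poly P 1 \<noteq> 0"
    and gf: "Abs_fps f * (1 - fps_X ^ D) ^ Suc m = fps_of_poly P"
  shows "quasi_polynomial m D f"
proof -
  let ?J = "\<lambda>n. {j \<in> {..<Suc m * D}. j mod D = n mod D}"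
  \<comment> \<open>\<open>Q j\<close> is the contribution of \<open>X^j / (1 - X^D)^(m + 1)\<close>; \<open>R n\<close> is the polynomial
    governing the residue class of \<open>n\<close>, and depends on \<open>n\<close> only through \<open>n mod D\<close>.\<close>
  define Q where "Q j = pcompose (binomial_poly m) [:- real j / D, 1 / D:]" for j
  define R where "R n = (\<Sum>j \<in> ?J n. smult (coeff P j) (Q j))" for n
  have poly_Q: "poly (Q j) (real n) = poly (binomial_poly m) ((real n - real j) / D)" for j n
    by (simp add: Q_def poly_pcompose diff_divide_distrib)
  have deg_Q: "degree (Q j) = m" for j
    using \<open>0 < D\<close> by (simp add: Q_def degree_pcompose binomial_poly_degree)
  have coeff_Q: "coeff (Q j) m = 1 / (fact m * real D ^ m)" for j
  proof -
    have "lead_coeff (Q j) = 1 / (fact m * real D ^ m)"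
      unfolding Q_def using \<open>0 < D\<close>
      by (subst lead_coeff_comp)
        (simp_all add: binomial_poly_degree binomial_poly_lead_coeff power_one_over)
    then show ?thesis
      by (simp add: deg_Q)
  qed
  have deg_R: "degree (R n) \<le> m" for n
    unfolding R_def by (intro degree_sum_le) (auto intro: order.trans[OF degree_smult_le] simp: deg_Q)
  have f_eq: "f n = poly (R n) (real n)" for n
  proof -
    have mod_eq: "j mod D = n mod D \<longleftrightarrow> D dvd n - j" if "j \<le> n" for j
      using mod_eq_dvd_iff_nat[OF that, of D] by auto
    have "((1 - fps_X ^ D :: real fps) ^ Suc m) $ 0 \<noteq> 0"
      using \<open>0 < D\<close> by (simp add: fps_nth_power_0 power_0_left del: power_Suc)
    then have "Abs_fps f = Abs_fps f * ((1 - fps_X ^ D) ^ Suc m * inverse ((1 - fps_X ^ D) ^ Suc m))"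
      by (simp add: inverse_mult_eq_1' del: power_Suc)
    also have "\<dots> = fps_of_poly P * inverse ((1 - fps_X ^ D) ^ Suc m)"
      by (simp add: gf[symmetric] mult.assoc del: power_Suc)
    finally have "Abs_fps f $ n = (fps_of_poly P * inverse ((1 - fps_X ^ D) ^ Suc m)) $ n"
      by simp
    then have "f n = (\<Sum>j\<le>n. coeff P j *
        (if D dvd n - j then real ((m + (n - j) div D) choose m) else 0))"
      using \<open>0 < D\<close>
      by (simp add: fps_mult_nth inverse_one_minus_fps_X_power_nth atLeast0AtMost del: power_Suc)
    also have "\<dots> = (\<Sum>j\<in>{j \<in> {..n}. j < Suc m * D \<and> j mod D = n mod D}.
        coeff P j * real ((m + (n - j) div D) choose m))"
    proof (rule sum.mono_neutral_cong_right)
      show "\<forall>j\<in>{..n} - {j \<in> {..n}. j < Suc m * D \<and> j mod D = n mod D}.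
          coeff P j * (if D dvd n - j then real ((m + (n - j) div D) choose m) else 0) = 0"
        using deg by (auto simp: mod_eq dest: le_degree)
    qed (auto simp: mod_eq)
    \<comment> \<open>Dropping the constraint \<open>j \<le> n\<close> only adds terms in which the binomial polynomial
      is evaluated at one of its roots.\<close>
    also have "\<dots> = (\<Sum>j\<in>?J n. coeff P j * poly (Q j) (real n))"
    proof (rule sum.mono_neutral_cong_left)
      show "\<forall>j\<in>?J n - {j \<in> {..n}. j < Suc m * D \<and> j mod D = n mod D}.
          coeff P j * poly (Q j) (real n) = 0"
      proof
        fix j assume j: "j \<in> ?J n - {j \<in> {..n}. j < Suc m * D \<and> j mod D = n mod D}"
        then have "n < j" "j < Suc m * D" "D dvd j - n"
          by (auto simp flip: mod_eq_dvd_iff_nat)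
        then obtain q where q: "j - n = D * q"
          by (elim dvdE)
        with \<open>n < j\<close> have "0 < q"
          by (cases q) auto
        have "D * q \<le> j"
          using q by (metis diff_le_self)
        also have "j < D * Suc m"
          using \<open>j < Suc m * D\<close> by (simp only: mult.commute)
        finally have "q \<le> m"
          using \<open>0 < D\<close> by (simp del: mult_Suc_right)
        have "(real n - real j) / D = - real q"
          using q \<open>n < j\<close> \<open>0 < D\<close> by (simp add: field_simps flip: of_nat_mult of_nat_add)
        then show "coeff P j * poly (Q j) (real n) = 0"
          using poly_binomial_poly_eq_0[OF \<open>0 < q\<close> \<open>q \<le> m\<close>] by (simp add: poly_Q)
      qed
    next
      fix j assume "j \<in> {j \<in> {..n}. j < Suc m * D \<and> j mod D = n mod D}"
      then have "j \<le> n" "D dvd n - j"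
        by (auto simp: mod_eq)
      then have "(real n - real j) / D = real ((n - j) div D)"
        using \<open>0 < D\<close> by (simp add: real_of_nat_div of_nat_diff)
      then show "coeff P j * real ((m + (n - j) div D) choose m) = coeff P j * poly (Q j) (real n)"
        by (simp add: poly_Q poly_binomial_poly_of_nat)
    qed auto
    also have "\<dots> = poly (R n) (real n)"
      by (simp add: R_def poly_sum)
    finally show ?thesis .
  qed
  have "f n = (\<Sum>i\<le>m. coeff (R n) i * real n ^ i)" for n
    unfolding f_eq poly_altdef using deg_R[of n]
    by (intro sum.mono_neutral_left) (auto simp: coeff_eq_0 not_le)
  moreover have "coeff (R (n + D)) i = coeff (R n) i" for i n
    by (simp add: R_def)
  moreover have "\<exists>n. coeff (R n) m \<noteq> 0"
  proof -
    \<comment> \<open>A single class may well have leading coefficient \<open>0\<close>, but over all classes the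
      coefficients of \<open>P\<close> are regrouped into \<open>P(1)\<close>.\<close>
    have "(\<Sum>n<D. coeff (R n) m) =
        (\<Sum>n<D. \<Sum>j\<in>?J n. coeff P j) / (fact m * real D ^ m)"
      by (simp add: R_def coeff_sum coeff_Q sum_divide_distrib)
    also have "(\<Sum>n<D. \<Sum>j\<in>?J n. coeff P j) =
        (\<Sum>n<D. \<Sum>j\<in>{j \<in> {..<Suc m * D}. j mod D = n}. coeff P j)"
      by (intro sum.cong) auto
    also have "\<dots> = (\<Sum>j<Suc m * D. coeff P j)"
      using \<open>0 < D\<close> by (intro sum.group) auto
    also have "\<dots> = poly P 1"
      unfolding poly_altdef using deg
      by (intro sum.mono_neutral_cong_right) (auto simp: coeff_eq_0 not_le)
    finally have "(\<Sum>n<D. coeff (R n) m) \<noteq> 0"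
      using P1 \<open>0 < D\<close> by simp
    then show ?thesis
      by (metis sum.neutral)
  qed
  ultimately show ?thesis
    unfolding quasi_polynomial_def by (intro exI[of _ "\<lambda>i n. coeff (R n) i"]) auto
qed

section \<open>A common denominator\<close>

text \<open>
  For \<open>a dvd D\<close> this is the quotient \<open>(1 - X^D) / (1 - X^a)\<close>.
\<close>

definition geometric_poly :: "nat \<Rightarrow> nat \<Rightarrow> real poly" where
  "geometric_poly D a = (\<Sum>q<D div a. monom 1 (a * q))"

lemma fps_of_poly_geometric_poly:
  assumes "a dvd D"
  shows "fps_of_poly (geometric_poly D a) * (1 - fps_X ^ a) = 1 - fps_X ^ D"
proof -
  have "fps_of_poly (geometric_poly D a) = (\<Sum>q<D div a. (fps_X ^ a) ^ q)"
    by (simp add: geometric_poly_def fps_of_poly_sum fps_of_poly_monom' power_mult)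
  then show ?thesis
    using assms one_diff_power_eq[of "fps_X ^ a :: real fps" "D div a"]
    by (simp add: mult.commute flip: power_mult)
qed

lemma degree_geometric_poly:
  assumes "0 < a"
  shows "degree (geometric_poly D a) \<le> D - a"
  unfolding geometric_poly_def
proof (intro degree_sum_le)
  fix q assume "q \<in> {..<D div a}"
  then have "a * Suc q \<le> a * (D div a)"
    by (intro mult_le_mono2) auto
  also have "\<dots> \<le> D"
    by simp
  finally show "degree (monom (1 :: real) (a * q)) \<le> D - a"
    by (simp add: degree_monom_eq)
qed simp

lemma poly_geometric_poly_1: "poly (geometric_poly D a) 1 = real (D div a)"
  by (simp add: geometric_poly_def poly_sum poly_monom)

text \<open>
  Each factor has degree at most \<open>D - a\<close> and \<open>a \<ge> 1\<close>, so every entry of \<open>as\<close> saves at least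
  one degree against \<open>D\<close>; for nonempty \<open>as\<close> this makes the fraction proper. At \<open>1\<close> the
  factors take the values \<open>D / a\<close>, which are nonzero.
\<close>

lemma rational_fps_common_denominator:
  assumes "\<forall>a \<in> set as. 0 < a \<and> a dvd D" "0 < D"
  defines "P \<equiv> (\<Prod>a\<leftarrow>as. geometric_poly D a)"
  shows "fps_of_poly P * (\<Prod>a\<leftarrow>as. 1 - fps_X ^ a) = (1 - fps_X ^ D) ^ length as"
    and "degree P + length as \<le> length as * D"
    and "poly P 1 \<noteq> 0"
proof -
  show "fps_of_poly P * (\<Prod>a\<leftarrow>as. 1 - fps_X ^ a) = (1 - fps_X ^ D) ^ length as"
    using assms(1) unfolding P_def
  proof (induction as)
    case (Cons a as)
    then have "(fps_of_poly (geometric_poly D a) * (1 - fps_X ^ a)) *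
        (fps_of_poly (\<Prod>a\<leftarrow>as. geometric_poly D a) * (\<Prod>a\<leftarrow>as. 1 - fps_X ^ a)) =
        (1 - fps_X ^ D) * (1 - fps_X ^ D) ^ length as"
      by (simp add: fps_of_poly_geometric_poly)
    then show ?case
      by (simp add: fps_of_poly_mult mult_ac)
  qed simp
  show "degree P + length as \<le> length as * D"
    using assms(1) unfolding P_def
  proof (induction as)
    case (Cons a as)
    have "degree (geometric_poly D a) < D"
      using degree_geometric_poly[of a D] Cons.prems \<open>0 < D\<close> by auto
    with Cons show ?case
      using degree_mult_le[of "geometric_poly D a" "\<Prod>a\<leftarrow>as. geometric_poly D a"] by simp
  qed simp
  show "poly P 1 \<noteq> 0"
    using assms(1,2) unfolding P_def
    by (induction as) (auto simp: poly_geometric_poly_1 elim!: dvdE)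
qed

theorem proposition2p5:
  fixes r k D :: nat and a :: "nat list"
  assumes "r \<ge> 1" and "k \<ge> 2"
    and "length a = r" and "\<forall>i<r. a ! i > 0"
    and "D = Lcm (set a)"
  shows "quasi_polynomial (r * k - 1) D (\<lambda>n. real (multipartition_count k a n))"
proof -
  have pos: "\<forall>b \<in> set a. 0 < b"
    using assms by (auto simp: in_set_conv_nth)
  have "0 \<notin> set a"
    using pos by auto
  then have "D \<noteq> 0"
    using assms by (simp add: Lcm_0_iff_nat)
  then have "0 < D"
    by simp
  have dvd: "\<forall>b \<in> set a. 0 < b \<and> b dvd D"
    using pos assms by (auto intro: dvd_Lcm)
  define P where "P = (\<Prod>b\<leftarrow>a. geometric_poly D b)"
  note P = rational_fps_common_denominator[OF dvd \<open>0 < D\<close>, folded P_def]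
  have s: "Suc (r * k - 1) = r * k"
    using assms by (cases r; cases k) auto
  let ?F = "Abs_fps (\<lambda>n. real (multipartition_count k a n))"
  show ?thesis
  proof (rule quasi_polynomial_if_rational_fps[where P = "P ^ k"])
    have "degree P < r * D"
      using P(2) assms by simp
    then have "degree P * k < r * D * k"
      using assms by simp
    then show "degree (P ^ k) < Suc (r * k - 1) * D"
      unfolding s using degree_power_le[of P k]
      by (metis le_less_trans mult.assoc mult.commute)
    show "poly (P ^ k) 1 \<noteq> 0"
      using P(3) by simp
    have "(1 - fps_X ^ D) ^ (r * k) = (fps_of_poly P * (\<Prod>b\<leftarrow>a. 1 - fps_X ^ b)) ^ k"
      by (simp only: P(1) power_mult assms(3))
    then have "?F * (1 - fps_X ^ D) ^ (r * k) =
        (?F * (\<Prod>b\<leftarrow>a. 1 - fps_X ^ b) ^ k) * fps_of_poly P ^ k"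
      by (simp add: power_mult_distrib mult_ac)
    then show "?F * (1 - fps_X ^ D) ^ Suc (r * k - 1) = fps_of_poly (P ^ k)"
      unfolding s multipartition_count_fps[OF pos] by (simp add: fps_of_poly_power)
  qed (fact \<open>0 < D\<close>)
qed

end
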